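(* Let $\mathcal{G}'\subseteq\mathcal{G}$ be an inclusion of crystallographs on the same set of nodes $\{1,\dots,n\}$, both disjoint unions of graphs of type $A$, $B$, $C$, $D$ and $BC$. Let $U=\mathrm{Ker}(\Phi^{\mathcal{G}'})=\bigcap_{\alpha\in\Phi^{\mathcal{G}'}}\mathrm{Ker}(\alpha)\subseteq V=\mathbb{C}^n$. Then $\Phi^{\mathcal{G}\setminus\mathcal{G}'}=\Phi^{\mathcal{G}}|_U$ as subsets of $U^\vee$, where $\mathcal{G}\setminus\mathcal{G}'$ denotes the quotient graph, $\Phi^{\mathcal{G}}|_U=\{\alpha|_U : \alpha\in\Phi^{\mathcal{G}}\setminus\Phi^{\mathcal{G}'}\}$ is the set of restrictions to $U$ of the remaining roots, and $\Phi^{\mathcal{G}\setminus\mathcal{G}'}$ is formed in $U^\vee$ using the basis of $U$ described in the context.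
   Context: Let $V=\mathbb{C}^n$ with canonical basis $(e_i)$ and dual basis $\alpha_i=e_i^\vee$. Bichromatic graphs: unoriented straight edges $\{i,j\}$ ($i\ne j$) and loop edges $\{k\}$, each coloured red or green, such that two distinct edges with the same underlying node set have different colours. Given a bichromatic graph on a finite node set $S$ and a vector space with a basis indexed by $S$ and dual basis $(\beta_s)_{s\in S}$, the associated set of covectors $\Phi^{\mathcal{G}}$ consists of $\pm(\beta_s-\beta_t)$ for each red straight edge $\{s,t\}$, $\pm(\beta_s+\beta_t)$ for each green straight edge $\{s,t\}$, $\pm\beta_s$ for each red loop at $s$, $\pm2\beta_s$ for each green loop at $s$. For $\mathcal{G}',\mathcal{G}$ one uses $V$ with $\beta_i=\alpha_i$. Crystallograph: a bichromatic graph such that (1) for any three distinct nodes $i,j,k$, if there are straight edges $\{i,j\}$, $\{j,k\}$ then there is a straight edge $\{i,k\}$, red if the first two have the same colour and green otherwise; (2) if a node $i$ is incident to a loop edge and to a straight edge $\{i,j\}$, then both the red and the green straight edge $\{i,j\}$ are present, as well as a loop edge at $j$ of the same colour as the one at $i$. Graphs on $m\ge1$ nodes: type $A$: exactly all red straight edges (an isolated node for $m=1$); type $D$ ($m\geq 2$): exactly all red and green straight edges; type $B$ (resp. $C$, $BC$): all red and green straight edges and a red (resp. green, resp. both a red and a green) loop at every node. A "red component" is a connected component of type $A$ (isolated nodes included); any other connected component is "bichromatic". Quotient graph $\mathcal{G}\setminus\mathcal{G}'$: its nodes are the red components of $\mathcal{G}'$, and its edges are exactly the following. (i) If $\mathcal{G}$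 has a straight edge between nodes of two distinct red components $\mathcal{G}'(i)$, $\mathcal{G}'(j)$ of $\mathcal{G}'$, put a straight edge of the same colour between them. (ii) If $\mathcal{G}$ has a green straight edge between two nodes of a red component $\mathcal{G}'(i)$, put a green loop at $\mathcal{G}'(i)$. (iii) If $\mathcal{G}$ has a straight edge from a node of a red component $\mathcal{G}'(i)$ to a node of a bichromatic component of $\mathcal{G}'$, put a red loop at $\mathcal{G}'(i)$. (iv) If $\mathcal{G}$ has a loop edge at a node of a red component $\mathcal{G}'(i)$, put a loop of the same colour at $\mathcal{G}'(i)$. (At most one edge per colour is kept.) The space $U$ has basis the vectors $e_{I}=\sum_{i\in I}e_i$, where $I$ runs through the node sets of the red components of $\mathcal{G}'$; $\Phi^{\mathcal{G}\setminus\mathcal{G}'}\subseteq U^\vee$ is formed with respect to its dual basis.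
   Formalization: The equality is proved after removing the zero covector from Φ^G|_U, and literally when no remaining root vanishes on U; as stated it fails, e.g. for G' of type D and G of type B on the same two nodes, where U=0, Φ^G|_U={0} and the quotient graph is empty. *)

theory Defs
  imports "HOL-Analysis.Analysis"
begin

section \<open>Bichromatic graphs\<close>

datatype colour = Red | Green

text \<open>An edge is a pair of its underlying node set and its colour: \<open>({i, j}, c)\<close> with \<open>i \<noteq> j\<close> is a
  straight edge and \<open>({k}, c)\<close> is a loop. Since edges form a set of such pairs, two distinct
  edges on the same node set automatically have different colours.\<close>

record 'a bigraph =
  nodes :: "'a set"
  edges :: "('a set \<times> colour) set"

definition bichromatic_graph :: "'a bigraph \<Rightarrow> bool" where
  "bichromatic_graph G \<longleftrightarrow> finite (nodes G) \<and>
     (\<forall>(e, c) \<in> edges G. e \<subseteq> nodes G \<and> (card e = 1 \<or> card e = 2))"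

definition crystallograph :: "'a bigraph \<Rightarrow> bool" where
  "crystallograph G \<longleftrightarrow> bichromatic_graph G \<and>
     (\<forall>i j k c d. i \<noteq> j \<and> j \<noteq> k \<and> i \<noteq> k \<and> ({i, j}, c) \<in> edges G \<and> ({j, k}, d) \<in> edges G
        \<longrightarrow> ({i, k}, if c = d then Red else Green) \<in> edges G) \<and>
     (\<forall>i j c d. i \<noteq> j \<and> ({i}, c) \<in> edges G \<and> ({i, j}, d) \<in> edges G
        \<longrightarrow> ({i, j}, Red) \<in> edges G \<and> ({i, j}, Green) \<in> edges G \<and> ({j}, c) \<in> edges G)"

definition subgraph_same_nodes :: "'a bigraph \<Rightarrow> 'a bigraph \<Rightarrow> bool" where
  "subgraph_same_nodes H G \<longleftrightarrow> nodes H = nodes G \<and> edges H \<subseteq> edges G"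


section \<open>Connected components and classical types\<close>

definition adjacency :: "'a bigraph \<Rightarrow> ('a \<times> 'a) set" where
  "adjacency G = {(i, j). i \<noteq> j \<and> (\<exists>c. ({i, j}, c) \<in> edges G)}"

text \<open>Components are represented by their node sets.\<close>

definition conn_components :: "'a bigraph \<Rightarrow> 'a set set" where
  "conn_components G = nodes G // (adjacency G)\<^sup>*"

definition induced :: "'a bigraph \<Rightarrow> 'a set \<Rightarrow> 'a bigraph" where
  "induced G C = \<lparr>nodes = C, edges = {(e, c) \<in> edges G. e \<subseteq> C}\<rparr>"

definition all_straight :: "'a set \<Rightarrow> colour \<Rightarrow> ('a set \<times> colour) set" where
  "all_straight S c = {({i, j}, c) | i j. i \<in> S \<and> j \<in> S \<and> i \<noteq> j}"

definition all_loops :: "'a set \<Rightarrow> colour \<Rightarrow> ('a set \<times> colour) set" where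
  "all_loops S c = {({i}, c) | i. i \<in> S}"

definition graph_A :: "'a set \<Rightarrow> 'a bigraph" where
  "graph_A S = \<lparr>nodes = S, edges = all_straight S Red\<rparr>"

definition graph_D :: "'a set \<Rightarrow> 'a bigraph" where
  "graph_D S = \<lparr>nodes = S, edges = all_straight S Red \<union> all_straight S Green\<rparr>"

definition graph_B :: "'a set \<Rightarrow> 'a bigraph" where
  "graph_B S = \<lparr>nodes = S,
     edges = all_straight S Red \<union> all_straight S Green \<union> all_loops S Red\<rparr>"

definition graph_C :: "'a set \<Rightarrow> 'a bigraph" where
  "graph_C S = \<lparr>nodes = S,
     edges = all_straight S Red \<union> all_straight S Green \<union> all_loops S Green\<rparr>"

definition graph_BC :: "'a set \<Rightarrow> 'a bigraph" where
  "graph_BC S = \<lparr>nodes = S,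
     edges = all_straight S Red \<union> all_straight S Green \<union> all_loops S Red \<union> all_loops S Green\<rparr>"

definition classical_type :: "'a bigraph \<Rightarrow> bool" where
  "classical_type H \<longleftrightarrow> finite (nodes H) \<and> nodes H \<noteq> {} \<and>
     (H = graph_A (nodes H) \<or> H = graph_B (nodes H) \<or> H = graph_C (nodes H) \<or>
      (card (nodes H) \<ge> 2 \<and> H = graph_D (nodes H)) \<or> H = graph_BC (nodes H))"

definition disjoint_union_classical :: "'a bigraph \<Rightarrow> bool" where
  "disjoint_union_classical G \<longleftrightarrow> (\<forall>C \<in> conn_components G. classical_type (induced G C))"

definition red_components :: "'a bigraph \<Rightarrow> 'a set set" where
  "red_components G = {C \<in> conn_components G. induced G C = graph_A C}"

definition bichromatic_components :: "'a bigraph \<Rightarrow> 'a set set" where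
  "bichromatic_components G = conn_components G - red_components G"


section \<open>The quotient graph\<close>

definition quotient_graph :: "'a bigraph \<Rightarrow> 'a bigraph \<Rightarrow> 'a set bigraph" where
  "quotient_graph G G' = \<lparr>nodes = red_components G',
     edges =
       {({I, J}, c) | I J c. I \<in> red_components G' \<and> J \<in> red_components G' \<and> I \<noteq> J \<and>
          (\<exists>i \<in> I. \<exists>j \<in> J. ({i, j}, c) \<in> edges G)} \<union>
       {({I}, Green) | I. I \<in> red_components G' \<and>
          (\<exists>i \<in> I. \<exists>j \<in> I. i \<noteq> j \<and> ({i, j}, Green) \<in> edges G)} \<union>
       {({I}, Red) | I. I \<in> red_components G' \<and>
          (\<exists>J \<in> bichromatic_components G'. \<exists>i \<in> I. \<exists>j \<in> J. \<exists>c. ({i, j}, c) \<in> edges G)} \<union>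
       {({I}, c) | I c. I \<in> red_components G' \<and> (\<exists>i \<in> I. ({i}, c) \<in> edges G)}\<rparr>"


section \<open>Covectors\<close>

text \<open>A covector on a subspace \<open>W\<close> is represented by a function that is \<open>undefined\<close> outside \<open>W\<close>
  (as produced by \<^const>\<open>restrict\<close>), so that equality of such functions is equality of
  covectors on \<open>W\<close>; for \<open>W = UNIV\<close> these are ordinary functions. The family \<open>\<beta>\<close> plays the
  role of the dual basis.\<close>

definition roots :: "'v set \<Rightarrow> ('s \<Rightarrow> 'v \<Rightarrow> complex) \<Rightarrow> 's bigraph \<Rightarrow> ('v \<Rightarrow> complex) set" where
  "roots W \<beta> G =
     {\<lambda>x\<in>W. \<epsilon> * (\<beta> s x - \<beta> t x) | \<epsilon> s t. \<epsilon> \<in> {1, -1} \<and> s \<noteq> t \<and> ({s, t}, Red) \<in> edges G} \<union>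
     {\<lambda>x\<in>W. \<epsilon> * (\<beta> s x + \<beta> t x) | \<epsilon> s t. \<epsilon> \<in> {1, -1} \<and> s \<noteq> t \<and> ({s, t}, Green) \<in> edges G} \<union>
     {\<lambda>x\<in>W. \<epsilon> * \<beta> s x | \<epsilon> s. \<epsilon> \<in> {1, -1} \<and> ({s}, Red) \<in> edges G} \<union>
     {\<lambda>x\<in>W. \<epsilon> * (2 * \<beta> s x) | \<epsilon> s. \<epsilon> \<in> {1, -1} \<and> ({s}, Green) \<in> edges G}"

definition ambient_roots :: "'n::finite bigraph \<Rightarrow> (complex^'n \<Rightarrow> complex) set" where
  "ambient_roots G = roots UNIV (\<lambda>i x. x $ i) G"

definition Ker :: "(complex^'n \<Rightarrow> complex) set \<Rightarrow> (complex^'n) set" where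
  "Ker \<Phi> = (\<Inter>\<alpha>\<in>\<Phi>. {x. \<alpha> x = 0})"

text \<open>This set may contain the zero covector: a root outside \<open>ambient_roots G'\<close> can still vanish on
  the kernel. For instance, if \<open>G'\<close> has type \<open>D\<close> and \<open>G\<close> type \<open>B\<close> on the same two nodes, the
  kernel is zero, the restrictions are \<open>{0}\<close>, and the quotient graph is empty.\<close>

definition restricted_roots ::
  "'n::finite bigraph \<Rightarrow> 'n bigraph \<Rightarrow> (complex^'n \<Rightarrow> complex) set" where
  "restricted_roots G G' =
     {restrict \<alpha> (Ker (ambient_roots G')) | \<alpha>. \<alpha> \<in> ambient_roots G - ambient_roots G'}"

definition node_vec :: "'n::finite set \<Rightarrow> complex^'n" where
  "node_vec I = (\<Sum>i\<in>I. axis i 1)"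

text \<open>The covector dual to \<open>node_vec I\<close>: the coefficient of \<open>node_vec I\<close> in the expansion of a
  vector in the basis consisting of all \<open>node_vec J\<close>, for \<open>J\<close> a red component of \<open>G'\<close>.
  That these vectors form a basis of the kernel is proved below.\<close>

definition component_dual_basis :: "'n::finite bigraph \<Rightarrow> 'n set \<Rightarrow> complex^'n \<Rightarrow> complex" where
  "component_dual_basis G' I x = vec.representation (node_vec ` red_components G') x (node_vec I)"

definition quotient_roots ::
  "'n::finite bigraph \<Rightarrow> 'n bigraph \<Rightarrow> (complex^'n \<Rightarrow> complex) set" where
  "quotient_roots G G' =
     roots (Ker (ambient_roots G')) (component_dual_basis G') (quotient_graph G G')"


section \<open>The basis of the kernel\<close>

lemma node_vec_nth: "node_vec I $ i = (if i \<in> I then 1 else 0)"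
  by (simp add: node_vec_def axis_def if_distrib cong: if_cong)

lemma sym_adjacency: "sym (adjacency G)"
  by (auto simp: sym_def adjacency_def insert_commute)

lemma equiv_adjacency: "equiv UNIV ((adjacency G)\<^sup>*)"
  by (auto simp: equiv_def refl_rtrancl trans_rtrancl intro: sym_rtrancl sym_adjacency)

lemma conn_component_unique:
  assumes "C \<in> conn_components G" "D \<in> conn_components G" "i \<in> C" "i \<in> D"
  shows "C = D"
proof -
  have "C \<in> UNIV // (adjacency G)\<^sup>*" "D \<in> UNIV // (adjacency G)\<^sup>*"
    using assms by (auto simp: conn_components_def quotient_def)
  then show ?thesis
    using quotient_disj[OF equiv_adjacency] assms by blast
qed

lemma conn_component_nonempty: "C \<in> conn_components G \<Longrightarrow> C \<noteq> {}"
  by (auto simp: conn_components_def quotient_def)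

lemma node_in_conn_component:
  assumes "i \<in> nodes G"
  obtains C where "C \<in> conn_components G" "i \<in> C"
  using assms by (auto simp: conn_components_def quotient_def)

lemma roots_red: "s \<noteq> t \<Longrightarrow> ({s, t}, Red) \<in> edges G \<Longrightarrow> \<epsilon> \<in> {1, -1} \<Longrightarrow>
    (\<lambda>x\<in>W. \<epsilon> * (\<beta> s x - \<beta> t x)) \<in> roots W \<beta> G"
  unfolding roots_def by (rule UnI1, rule UnI1, rule UnI1) blast

lemma roots_green: "s \<noteq> t \<Longrightarrow> ({s, t}, Green) \<in> edges G \<Longrightarrow> \<epsilon> \<in> {1, -1} \<Longrightarrow>
    (\<lambda>x\<in>W. \<epsilon> * (\<beta> s x + \<beta> t x)) \<in> roots W \<beta> G"
  unfolding roots_def by (rule UnI1, rule UnI1, rule UnI2) blast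

lemma roots_red_loop: "({s}, Red) \<in> edges G \<Longrightarrow> \<epsilon> \<in> {1, -1} \<Longrightarrow>
    (\<lambda>x\<in>W. \<epsilon> * \<beta> s x) \<in> roots W \<beta> G"
  unfolding roots_def by (rule UnI1, rule UnI2) blast

lemma roots_green_loop: "({s}, Green) \<in> edges G \<Longrightarrow> \<epsilon> \<in> {1, -1} \<Longrightarrow>
    (\<lambda>x\<in>W. \<epsilon> * (2 * \<beta> s x)) \<in> roots W \<beta> G"
  unfolding roots_def by (rule UnI2) blast

lemma rootsE:
  assumes "\<alpha> \<in> roots W \<beta> G"
  obtains (red) \<epsilon> s t where "\<alpha> = (\<lambda>x\<in>W. \<epsilon> * (\<beta> s x - \<beta> t x))" "\<epsilon> \<in> {1, -1}" "s \<noteq> t" "({s, t}, Red) \<in> edges G"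
    | (green) \<epsilon> s t where "\<alpha> = (\<lambda>x\<in>W. \<epsilon> * (\<beta> s x + \<beta> t x))" "\<epsilon> \<in> {1, -1}" "s \<noteq> t" "({s, t}, Green) \<in> edges G"
    | (red_loop) \<epsilon> s where "\<alpha> = (\<lambda>x\<in>W. \<epsilon> * \<beta> s x)" "\<epsilon> \<in> {1, -1}" "({s}, Red) \<in> edges G"
    | (green_loop) \<epsilon> s where "\<alpha> = (\<lambda>x\<in>W. \<epsilon> * (2 * \<beta> s x))" "\<epsilon> \<in> {1, -1}" "({s}, Green) \<in> edges G"
  using assms unfolding roots_def by (elim UnE CollectE exE conjE)

lemma mem_Ker_ambient_roots_iff:
  "x \<in> Ker (ambient_roots G) \<longleftrightarrow>
     (\<forall>s t. s \<noteq> t \<longrightarrow> ({s, t}, Red) \<in> edges G \<longrightarrow> x $ s = x $ t) \<and>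
     (\<forall>s t. s \<noteq> t \<longrightarrow> ({s, t}, Green) \<in> edges G \<longrightarrow> x $ s + x $ t = 0) \<and>
     (\<forall>s c. ({s}, c) \<in> edges G \<longrightarrow> x $ s = 0)" (is "?L \<longleftrightarrow> ?R")
proof
  assume L: ?L
  have *: "\<alpha> x = 0" if "\<alpha> \<in> roots UNIV (\<lambda>i x. x $ i) G" for \<alpha>
    using L that by (simp add: Ker_def ambient_roots_def)
  show ?R
  proof (intro conjI allI impI)
    fix s t :: 'a assume "s \<noteq> t" "({s, t}, Red) \<in> edges G"
    then show "x $ s = x $ t"
      using *[OF roots_red[of s t G 1]] by simp
  next
    fix s t :: 'a assume "s \<noteq> t" "({s, t}, Green) \<in> edges G"
    then show "x $ s + x $ t = 0"
      using *[OF roots_green[of s t G 1]] by simp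
  next
    fix s c assume "({s}, c) \<in> edges G"
    then show "x $ s = 0"
      using *[OF roots_red_loop[of s G 1]] *[OF roots_green_loop[of s G 1]] by (cases c) simp_all
  qed
next
  assume R: ?R
  have "\<alpha> x = 0" if "\<alpha> \<in> roots UNIV (\<lambda>i x. x $ i) G" for \<alpha>
    using that
  proof (cases rule: rootsE)
    case (red \<epsilon> s t)
    then have "x $ s = x $ t" using R by metis
    then show ?thesis using red(1) by simp
  next
    case (green \<epsilon> s t)
    then have "x $ s + x $ t = 0" using R by metis
    then show ?thesis using green(1) by simp
  next
    case (red_loop \<epsilon> s)
    then have "x $ s = 0" using R by metis
    then show ?thesis using red_loop(1) by simp
  next
    case (green_loop \<epsilon> s)
    then have "x $ s = 0" using R by metis
    then show ?thesis using green_loop(1) by simp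
  qed
  then show ?L
    by (simp add: Ker_def ambient_roots_def)
qed

lemma Ker_red: "x \<in> Ker (ambient_roots G) \<Longrightarrow> s \<noteq> t \<Longrightarrow> ({s, t}, Red) \<in> edges G \<Longrightarrow> x $ s = x $ t"
  unfolding mem_Ker_ambient_roots_iff by metis

lemma Ker_green: "x \<in> Ker (ambient_roots G) \<Longrightarrow> s \<noteq> t \<Longrightarrow> ({s, t}, Green) \<in> edges G \<Longrightarrow> x $ s + x $ t = 0"
  unfolding mem_Ker_ambient_roots_iff by metis

lemma Ker_loop: "x \<in> Ker (ambient_roots G) \<Longrightarrow> ({s}, c) \<in> edges G \<Longrightarrow> x $ s = 0"
  unfolding mem_Ker_ambient_roots_iff by metis

lemma edge_in_component:
  assumes "bichromatic_graph G" "({i, j}, c) \<in> edges G"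
  obtains C where "C \<in> conn_components G" "i \<in> C" "j \<in> C"
proof -
  have "i \<in> nodes G"
    using assms by (auto simp: bichromatic_graph_def)
  moreover have "(i, j) \<in> (adjacency G)\<^sup>*"
    using assms by (cases "i = j") (auto simp: adjacency_def)
  ultimately show ?thesis
    using that[of "(adjacency G)\<^sup>* `` {i}"] by (auto simp: conn_components_def quotient_def)
qed

lemma induced_edge: "e \<subseteq> C \<Longrightarrow> (e, c) \<in> edges (induced G C) \<longleftrightarrow> (e, c) \<in> edges G"
  by (simp add: induced_def)

lemma red_component_edge:
  assumes "C \<in> red_components G" "i \<in> C" "j \<in> C"
  shows "({i, j}, c) \<in> edges G \<longleftrightarrow> i \<noteq> j \<and> c = Red"
proof -
  have "edges (induced G C) = all_straight C Red"
    using assms by (simp add: red_components_def graph_A_def)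
  moreover have "({i, j}, c) \<in> edges (induced G C) \<longleftrightarrow> ({i, j}, c) \<in> edges G"
    using assms by (simp add: induced_edge)
  ultimately show ?thesis
    using assms by (auto simp: all_straight_def doubleton_eq_iff)
qed

lemma bichromatic_component_zero:
  assumes "disjoint_union_classical G" "C \<in> bichromatic_components G" "i \<in> C"
    and x: "x \<in> Ker (ambient_roots G)"
  shows "x $ i = 0"
proof -
  have C: "C \<in> conn_components G" "induced G C \<noteq> graph_A C"
    using assms by (auto simp: bichromatic_components_def red_components_def)
  have nC: "nodes (induced G C) = C"
    by (simp add: induced_def)
  have cl: "classical_type (induced G C)"
    using assms C by (simp add: disjoint_union_classical_def)
  have sub: "edges (induced G C) \<subseteq> edges G"
    by (auto simp: induced_def)
  have "({i}, Red) \<in> edges (graph_B C)" "({i}, Green) \<in> edges (graph_C C)"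
    "({i}, Red) \<in> edges (graph_BC C)"
    using \<open>i \<in> C\<close> by (auto simp: graph_B_def graph_C_def graph_BC_def all_loops_def)
  then consider c where "({i}, c) \<in> edges (induced G C)"
    | "card C \<ge> 2" "induced G C = graph_D C"
    using cl C(2) unfolding classical_type_def nC by metis
  then show ?thesis
  proof cases
    case 1
    then show ?thesis
      using Ker_loop[OF x] sub by blast
  next
    case 2
    have "\<not> C \<subseteq> {i}"
      using card_mono[of "{i}" C] 2(1) by auto
    then obtain j where "j \<in> C" "j \<noteq> i" by blast
    then have "({i, j}, Red) \<in> edges (graph_D C)" "({i, j}, Green) \<in> edges (graph_D C)"
      using \<open>i \<in> C\<close> by (auto simp: graph_D_def all_straight_def)
    then have "({i, j}, Red) \<in> edges G" "({i, j}, Green) \<in> edges G"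
      using 2(2) sub by auto
    then have "x $ i = x $ j" "x $ i + x $ j = 0"
      using Ker_red[OF x] Ker_green[OF x] \<open>j \<noteq> i\<close> by metis+
    then show ?thesis by simp
  qed
qed

lemma Ker_constant_on_red_component:
  assumes "x \<in> Ker (ambient_roots G)" "C \<in> red_components G" "i \<in> C" "j \<in> C"
  shows "x $ i = x $ j"
proof (cases "i = j")
  case False
  then have "({i, j}, Red) \<in> edges G"
    using red_component_edge[OF assms(2-4)] by simp
  then show ?thesis
    using Ker_red[OF assms(1)] False by metis
qed simp

lemma node_vec_in_Ker:
  assumes "bichromatic_graph G" "I \<in> red_components G"
  shows "node_vec I \<in> Ker (ambient_roots G)"
proof -
  have I: "I \<in> conn_components G"
    using assms by (simp add: red_components_def)
  have same: "i \<in> I \<longleftrightarrow> j \<in> I" if "({i, j}, c) \<in> edges G" for i j c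
    by (rule edge_in_component[OF assms(1) that]) (use conn_component_unique I in metis)
  have no: "i \<notin> I \<or> j \<notin> I" if "({i, j}, Green) \<in> edges G" for i j
    using red_component_edge[OF assms(2), of i j Green] that by auto
  have nl: "i \<notin> I" if "({i}, c) \<in> edges G" for i c
    using red_component_edge[OF assms(2), of i i c] that by auto
  show ?thesis
    unfolding mem_Ker_ambient_roots_iff
  proof (intro conjI allI impI)
    fix s t assume "({s, t}, Red) \<in> edges G"
    then show "node_vec I $ s = node_vec I $ t"
      using same[of s t Red] by (simp add: node_vec_nth)
  next
    fix s t assume "({s, t}, Green) \<in> edges G"
    then show "node_vec I $ s + node_vec I $ t = 0"
      using same[of s t Green] no[of s t] by (auto simp: node_vec_nth)
  next
    fix s c assume "({s}, c) \<in> edges G"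
    then show "node_vec I $ s = 0"
      using nl[of s c] by (simp add: node_vec_nth)
  qed
qed

lemma inj_node_vec: "inj node_vec"
proof (rule injI)
  fix I J :: "'a set"
  assume "node_vec I = node_vec J"
  then have "node_vec I $ i = node_vec J $ i" for i
    by simp
  then have "i \<in> I \<longleftrightarrow> i \<in> J" for i
    unfolding node_vec_nth by (metis zero_neq_one)
  then show "I = J"
    by blast
qed

lemma sum_node_vec_nth:
  assumes "I \<in> red_components G" "i \<in> I"
  shows "(\<Sum>J\<in>red_components G. f J *s node_vec J) $ i = f I"
proof -
  have "(\<Sum>J\<in>red_components G. f J *s node_vec J) $ i
      = (\<Sum>J\<in>red_components G. if J = I then f J else 0)"
    unfolding sum_component
  proof (rule sum.cong[OF refl])
    fix J assume "J \<in> red_components G"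
    then have "i \<in> J \<longleftrightarrow> J = I"
      using assms conn_component_unique[of J G I i] by (auto simp: red_components_def)
    then show "(f J *s node_vec J) $ i = (if J = I then f J else 0)"
      by (simp add: node_vec_nth)
  qed
  also have "\<dots> = f I"
    using assms by simp
  finally show ?thesis .
qed

lemma node_vec_expansion:
  assumes "nodes G = UNIV" "disjoint_union_classical G" "x \<in> Ker (ambient_roots G)"
  shows "x = (\<Sum>I\<in>red_components G. (x $ (SOME i. i \<in> I)) *s node_vec I)"
proof (rule vec_eq_iff[THEN iffD2, OF allI])
  fix i
  obtain C where C: "C \<in> conn_components G" "i \<in> C"
    using node_in_conn_component[of i G] assms(1) by auto
  show "x $ i = (\<Sum>I\<in>red_components G. (x $ (SOME i. i \<in> I)) *s node_vec I) $ i"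
  proof (cases "C \<in> red_components G")
    case True
    then show ?thesis
      using sum_node_vec_nth[OF True C(2), of "\<lambda>I. x $ (SOME i. i \<in> I)"]
        Ker_constant_on_red_component[OF assms(3) True C(2), of "SOME i. i \<in> C"] C(2)
        someI[of "\<lambda>i. i \<in> C" i] by simp
  next
    case False
    then have "i \<notin> I" if "I \<in> red_components G" for I
      using that C conn_component_unique[of I G C i] by (auto simp: red_components_def)
    then have "(\<Sum>I\<in>red_components G. (x $ (SOME i. i \<in> I)) *s node_vec I) $ i = 0"
      by (simp add: node_vec_nth)
    moreover have "x $ i = 0"
      using bichromatic_component_zero[OF assms(2) _ C(2) assms(3)] C False
      by (simp add: bichromatic_components_def)
    ultimately show ?thesis by simp
  qed
qed

lemma independent_node_vec: "vec.independent (node_vec ` red_components G)"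
proof (rule vec.independent_if_scalars_zero)
  fix f and v :: "complex^'a"
  assume 0: "(\<Sum>v\<in>node_vec ` red_components G. f v *s v) = 0"
    and v: "v \<in> node_vec ` red_components G"
  obtain I where I: "I \<in> red_components G" "v = node_vec I" using v by blast
  then obtain i where "i \<in> I"
    using conn_component_nonempty[of I G] by (auto simp: red_components_def)
  moreover have "(\<Sum>J\<in>red_components G. f (node_vec J) *s node_vec J) = 0"
    using 0 inj_node_vec by (subst (asm) sum.reindex) (auto intro: inj_on_subset)
  ultimately show "f v = 0"
    using sum_node_vec_nth[OF I(1), of i "\<lambda>J. f (node_vec J)"] I by simp
qed auto

lemma span_node_vec:
  assumes "bichromatic_graph G" "nodes G = UNIV" "disjoint_union_classical G"
  shows "vec.span (node_vec ` red_components G) = Ker (ambient_roots G)"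
proof
  have "vec.subspace (Ker (ambient_roots G))"
  proof (rule vec.subspaceI)
    fix x y assume "x \<in> Ker (ambient_roots G)" "y \<in> Ker (ambient_roots G)"
    note K = Ker_red[OF this(1)] Ker_red[OF this(2)] Ker_green[OF this(1)] Ker_green[OF this(2)]
      Ker_loop[OF this(1)] Ker_loop[OF this(2)]
    show "x + y \<in> Ker (ambient_roots G)"
      unfolding mem_Ker_ambient_roots_iff
    proof (intro conjI allI impI)
      fix s t :: 'a assume "s \<noteq> t" "({s, t}, Red) \<in> edges G"
      then show "(x + y) $ s = (x + y) $ t"
        using K(1,2)[of s t] by simp
    next
      fix s t :: 'a assume "s \<noteq> t" "({s, t}, Green) \<in> edges G"
      then have "(x $ s + x $ t) + (y $ s + y $ t) = 0"
        using K(3,4)[of s t] by simp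
      then show "(x + y) $ s + (x + y) $ t = 0"
        by (simp add: algebra_simps)
    next
      fix s c assume "({s}, c) \<in> edges G"
      then show "(x + y) $ s = 0"
        using K(5,6)[of s c] by simp
    qed
  next
    fix a :: complex and x assume x: "x \<in> Ker (ambient_roots G)"
    show "a *s x \<in> Ker (ambient_roots G)"
      unfolding mem_Ker_ambient_roots_iff
    proof (intro conjI allI impI)
      fix s t :: 'a assume "s \<noteq> t" "({s, t}, Red) \<in> edges G"
      then show "(a *s x) $ s = (a *s x) $ t"
        using Ker_red[OF x, of s t] by simp
    next
      fix s t :: 'a assume "s \<noteq> t" "({s, t}, Green) \<in> edges G"
      then show "(a *s x) $ s + (a *s x) $ t = 0"
        using Ker_green[OF x, of s t] by (simp flip: distrib_left)
    next
      fix s c assume "({s}, c) \<in> edges G"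
      then show "(a *s x) $ s = 0"
        using Ker_loop[OF x, of s c] by simp
    qed
  qed (simp add: mem_Ker_ambient_roots_iff)
  then show "vec.span (node_vec ` red_components G) \<subseteq> Ker (ambient_roots G)"
    using node_vec_in_Ker[OF assms(1)] by (intro vec.span_minimal) auto
  show "Ker (ambient_roots G) \<subseteq> vec.span (node_vec ` red_components G)"
  proof
    fix x assume x: "x \<in> Ker (ambient_roots G)"
    have "(\<Sum>I\<in>red_components G. (x $ (SOME i. i \<in> I)) *s node_vec I)
        \<in> vec.span (node_vec ` red_components G)"
      by (intro vec.span_sum vec.span_scale vec.span_base imageI)
    then show "x \<in> vec.span (node_vec ` red_components G)"
      using node_vec_expansion[OF assms(2,3) x] by metis
  qed
qed

text \<open>Dual basis covectors are read off from any coordinate in the component.\<close>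

lemma component_dual_basis_eq:
  assumes "bichromatic_graph G" "nodes G = UNIV" "disjoint_union_classical G"
    and "x \<in> Ker (ambient_roots G)" "I \<in> red_components G" "i \<in> I"
  shows "component_dual_basis G I x = x $ i"
proof -
  let ?B = "node_vec ` red_components G"
  have "x = (\<Sum>b\<in>?B. vec.representation ?B x b *s b)"
    using vec.sum_representation_eq[OF independent_node_vec, of x G ?B] assms
    by (simp add: span_node_vec)
  also have "\<dots> = (\<Sum>J\<in>red_components G. component_dual_basis G J x *s node_vec J)"
    unfolding component_dual_basis_def
    using inj_node_vec by (subst sum.reindex) (auto intro: inj_on_subset)
  finally have "x $ i = (\<Sum>J\<in>red_components G. component_dual_basis G J x *s node_vec J) $ i"
    by (rule arg_cong)
  then show ?thesis
    using sum_node_vec_nth[OF assms(5,6), of "\<lambda>J. component_dual_basis G J x"] by simp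
qed

end

theory Submission
  imports Defs
begin

text \<open>Let \<open>U\<close> be the kernel of the roots of \<open>G'\<close>. On \<open>U\<close> the coordinate \<open>x $ s\<close> takes one of two
  forms: it is the dual basis covector of the red component of \<open>G'\<close> containing \<open>s\<close>, or it is zero
  because \<open>s\<close> lies in a bichromatic component (\<open>coordinate_on_Ker\<close>). Substituting this into the root
  of an edge of \<open>G\<close> leaves few possibilities. An edge between two distinct red components gives
  \<open>\<plusminus>(\<beta> I - \<beta> J)\<close> or \<open>\<plusminus>(\<beta> I + \<beta> J)\<close>; a green edge inside a red component gives \<open>\<plusminus>2 \<beta> I\<close>; an edge
  from a red to a bichromatic component loses one of its two terms and gives \<open>\<plusminus>\<beta> I\<close>, whatever its
  colour; a loop at a node of a red component gives \<open>\<plusminus>\<beta> I\<close> or \<open>\<plusminus>2 \<beta> I\<close>; all other edges give zero.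
  These are precisely the rules by which the quotient graph receives its edges, so the nonzero
  restrictions of roots of \<open>G\<close> are the roots of the quotient graph
  (\<open>restricted_root_zero_or_quotient_root\<close> and \<open>quotient_root_is_restriction\<close>).

  No root of the quotient graph is zero, as one sees by evaluating it at a basis vector of \<open>U\<close>
  (\<open>quotient_root_nonzero\<close>). Since the roots of \<open>G'\<close> vanish on \<open>U\<close>, a root of \<open>G\<close> that
  restricts to a root of the quotient graph is not a root of \<open>G'\<close>, so its restriction does belong to
  \<open>restricted_roots G G'\<close>.\<close>

section \<open>Edges of the quotient graph\<close>

lemma quotient_straight_edgeI:
  assumes "I \<in> red_components G'" "J \<in> red_components G'" "I \<noteq> J"
    and "i \<in> I" "j \<in> J" "({i, j}, c) \<in> edges G"
  shows "({I, J}, c) \<in> edges (quotient_graph G G')"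
  using assms unfolding quotient_graph_def by auto

lemma quotient_green_loopI:
  assumes "I \<in> red_components G'" "i \<in> I" "j \<in> I" "i \<noteq> j" "({i, j}, Green) \<in> edges G"
  shows "({I}, Green) \<in> edges (quotient_graph G G')"
  using assms unfolding quotient_graph_def by auto

lemma quotient_red_loopI:
  assumes "I \<in> red_components G'" "J \<in> bichromatic_components G'"
    and "i \<in> I" "j \<in> J" "({i, j}, c) \<in> edges G"
  shows "({I}, Red) \<in> edges (quotient_graph G G')"
  using assms unfolding quotient_graph_def by auto

lemma quotient_loopI:
  assumes "I \<in> red_components G'" "i \<in> I" "({i}, c) \<in> edges G"
  shows "({I}, c) \<in> edges (quotient_graph G G')"
  using assms unfolding quotient_graph_def by auto

lemma quotient_straight_edgeE:
  assumes "({I, J}, c) \<in> edges (quotient_graph G G')" "I \<noteq> J"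
  obtains i j where "I \<in> red_components G'" "J \<in> red_components G'"
    "i \<in> I" "j \<in> J" "({i, j}, c) \<in> edges G"
proof -
  obtain K L i j where *: "{I, J} = {K, L}" "K \<in> red_components G'" "L \<in> red_components G'"
      "i \<in> K" "j \<in> L" "({i, j}, c) \<in> edges G"
    using assms unfolding quotient_graph_def by auto
  moreover have "({j, i}, c) \<in> edges G"
    using *(6) by (simp add: insert_commute)
  ultimately show ?thesis
    using that by (auto simp: doubleton_eq_iff)
qed

lemma quotient_loopE:
  assumes "({I}, c) \<in> edges (quotient_graph G G')"
  obtains
    (green_edge) i j where "I \<in> red_components G'" "c = Green" "i \<in> I" "j \<in> I" "i \<noteq> j"
      "({i, j}, Green) \<in> edges G"
  | (bichromatic_edge) J i j d where "I \<in> red_components G'" "c = Red"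
      "J \<in> bichromatic_components G'" "i \<in> I" "j \<in> J" "({i, j}, d) \<in> edges G"
  | (loop) i where "I \<in> red_components G'" "i \<in> I" "({i}, c) \<in> edges G"
  using assms unfolding quotient_graph_def by auto

section \<open>Restricting roots to the kernel\<close>

lemma restrict_ambient_root:
  assumes "\<alpha> = (\<lambda>x\<in>UNIV. f x)"
  shows "restrict \<alpha> W = (\<lambda>x\<in>W. f x)"
  using assms by (simp add: restrict_def)

lemma red_component_nonempty: "I \<in> red_components G \<Longrightarrow> I \<noteq> {}"
  using conn_component_nonempty[of I G] by (simp add: red_components_def)

lemma red_components_disjoint:
  "I \<in> red_components G \<Longrightarrow> J \<in> red_components G \<Longrightarrow> I \<noteq> J \<Longrightarrow> i \<in> I \<Longrightarrow> i \<notin> J"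
  using conn_component_unique[of I G J i] by (auto simp: red_components_def)

lemma red_bichromatic_disjoint:
  "I \<in> red_components G \<Longrightarrow> J \<in> bichromatic_components G \<Longrightarrow> i \<in> I \<Longrightarrow> i \<notin> J"
  using conn_component_unique[of I G J i]
  by (auto simp: red_components_def bichromatic_components_def)

context
  fixes G' :: "'n::finite bigraph"
  assumes bichromatic: "bichromatic_graph G'"
    and nodes_UNIV: "nodes G' = UNIV"
    and classical: "disjoint_union_classical G'"
begin

abbreviation (input) "U \<equiv> Ker (ambient_roots G')"
abbreviation (input) "\<beta> \<equiv> component_dual_basis G'"

lemmas dual_eq = component_dual_basis_eq[OF bichromatic nodes_UNIV classical]
lemmas bichromatic_zero = bichromatic_component_zero[OF classical]

text \<open>The red edges of \<open>G'\<close> force the coordinates of a vector of \<open>U\<close> to agree along a red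
  component, where their common value is its coefficient on \<open>node_vec I\<close>. In a bichromatic component
  a loop, or a red and a green edge on the same two nodes, forces them to be zero.\<close>

lemma coordinate_on_Ker:
  obtains (red) I where "I \<in> red_components G'" "s \<in> I" "\<And>x. x \<in> U \<Longrightarrow> x $ s = \<beta> I x"
  | (bichromatic) J where "J \<in> bichromatic_components G'" "s \<in> J" "\<And>x. x \<in> U \<Longrightarrow> x $ s = 0"
proof -
  obtain C where C: "C \<in> conn_components G'" "s \<in> C"
    using node_in_conn_component[of s G'] nodes_UNIV by auto
  show ?thesis
  proof (cases "C \<in> red_components G'")
    case True
    then show ?thesis
      using red[OF True C(2)] dual_eq[OF _ True C(2)] by simp
  next
    case False
    then have "C \<in> bichromatic_components G'"
      using C by (simp add: bichromatic_components_def)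
    then show ?thesis
      using bichromatic[OF _ C(2)] bichromatic_zero[OF _ C(2)] by blast
  qed
qed

text \<open>Each end of the edge defining the root lies in a red or in a bichromatic component of \<open>G'\<close>, and
  each combination that does not give zero matches one of the four rules by which the quotient graph
  receives an edge.\<close>

lemma restricted_root_zero_or_quotient_root:
  assumes "\<alpha> \<in> ambient_roots G"
  shows "restrict \<alpha> U = (\<lambda>x\<in>U. 0) \<or> restrict \<alpha> U \<in> quotient_roots G G'"
  using assms[unfolded ambient_roots_def]
proof (cases rule: rootsE)
  case (red \<epsilon> s t)
  note \<alpha> = restrict_ambient_root[OF red(1), of U]
  have ts: "({t, s}, Red) \<in> edges G"
    using red(4) by (simp add: insert_commute)
  show ?thesis
  proof (cases s rule: coordinate_on_Ker)
    case s: (red I)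
    show ?thesis
    proof (cases t rule: coordinate_on_Ker)
      case t: (red J)
      have eq: "restrict \<alpha> U = (\<lambda>x\<in>U. \<epsilon> * (\<beta> I x - \<beta> J x))"
        unfolding \<alpha> by (rule restrict_ext) (simp add: s(3) t(3))
      show ?thesis
      proof (cases "I = J")
        case True
        then show ?thesis using eq by simp
      next
        case False
        show ?thesis
          unfolding eq quotient_roots_def
          by (intro disjI2 roots_red[OF False quotient_straight_edgeI[OF s(1) t(1) False s(2) t(2) red(4)] red(2)])
      qed
    next
      case t: (bichromatic J)
      have eq: "restrict \<alpha> U = (\<lambda>x\<in>U. \<epsilon> * \<beta> I x)"
        unfolding \<alpha> by (rule restrict_ext) (simp add: s(3) t(3))
      show ?thesis
        unfolding eq quotient_roots_def
        by (intro disjI2 roots_red_loop[OF quotient_red_loopI[OF s(1) t(1) s(2) t(2) red(4)] red(2)])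
    qed
  next
    case s: (bichromatic J)
    show ?thesis
    proof (cases t rule: coordinate_on_Ker)
      case t: (red I)
      \<comment> \<open>The surviving end is the one with the minus sign, which passes to \<open>\<epsilon>\<close>.\<close>
      have eq: "restrict \<alpha> U = (\<lambda>x\<in>U. (- \<epsilon>) * \<beta> I x)"
        unfolding \<alpha> by (rule restrict_ext) (simp add: s(3) t(3))
      have "- \<epsilon> \<in> {1, -1}"
        using red(2) by auto
      show ?thesis
        unfolding eq quotient_roots_def
        by (intro disjI2 roots_red_loop[OF quotient_red_loopI[OF t(1) s(1) t(2) s(2) ts] \<open>- \<epsilon> \<in> {1, -1}\<close>])
    next
      case t: (bichromatic J')
      have "restrict \<alpha> U = (\<lambda>x\<in>U. 0)"
        unfolding \<alpha> by (rule restrict_ext) (simp add: s(3) t(3))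
      then show ?thesis ..
    qed
  qed
next
  case (green \<epsilon> s t)
  note \<alpha> = restrict_ambient_root[OF green(1), of U]
  have ts: "({t, s}, Green) \<in> edges G"
    using green(4) by (simp add: insert_commute)
  show ?thesis
  proof (cases s rule: coordinate_on_Ker)
    case s: (red I)
    show ?thesis
    proof (cases t rule: coordinate_on_Ker)
      case t: (red J)
      have eq: "restrict \<alpha> U = (\<lambda>x\<in>U. \<epsilon> * (\<beta> I x + \<beta> J x))"
        unfolding \<alpha> by (rule restrict_ext) (simp add: s(3) t(3))
      show ?thesis
      proof (cases "I = J")
        case True
        have eq2: "restrict \<alpha> U = (\<lambda>x\<in>U. \<epsilon> * (2 * \<beta> I x))"
          using eq True by simp
        have "t \<in> I"
          using t(2) True by simp
        show ?thesis
          unfolding eq2 quotient_roots_def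
          by (intro disjI2 roots_green_loop[OF quotient_green_loopI[OF s(1) s(2) \<open>t \<in> I\<close> green(3,4)] green(2)])
      next
        case False
        show ?thesis
          unfolding eq quotient_roots_def
          by (intro disjI2 roots_green[OF False quotient_straight_edgeI[OF s(1) t(1) False s(2) t(2) green(4)] green(2)])
      qed
    next
      case t: (bichromatic J)
      have eq: "restrict \<alpha> U = (\<lambda>x\<in>U. \<epsilon> * \<beta> I x)"
        unfolding \<alpha> by (rule restrict_ext) (simp add: s(3) t(3))
      show ?thesis
        unfolding eq quotient_roots_def
        by (intro disjI2 roots_red_loop[OF quotient_red_loopI[OF s(1) t(1) s(2) t(2) green(4)] green(2)])
    qed
  next
    case s: (bichromatic J)
    show ?thesis
    proof (cases t rule: coordinate_on_Ker)
      case t: (red I)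
      have eq: "restrict \<alpha> U = (\<lambda>x\<in>U. \<epsilon> * \<beta> I x)"
        unfolding \<alpha> by (rule restrict_ext) (simp add: s(3) t(3))
      show ?thesis
        unfolding eq quotient_roots_def
        by (intro disjI2 roots_red_loop[OF quotient_red_loopI[OF t(1) s(1) t(2) s(2) ts] green(2)])
    next
      case t: (bichromatic J')
      have "restrict \<alpha> U = (\<lambda>x\<in>U. 0)"
        unfolding \<alpha> by (rule restrict_ext) (simp add: s(3) t(3))
      then show ?thesis ..
    qed
  qed
next
  case (red_loop \<epsilon> s)
  note \<alpha> = restrict_ambient_root[OF red_loop(1), of U]
  show ?thesis
  proof (cases s rule: coordinate_on_Ker)
    case s: (red I)
    have eq: "restrict \<alpha> U = (\<lambda>x\<in>U. \<epsilon> * \<beta> I x)"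
      unfolding \<alpha> by (rule restrict_ext) (simp add: s(3))
    show ?thesis
      unfolding eq quotient_roots_def
      by (intro disjI2 roots_red_loop[OF quotient_loopI[OF s(1,2) red_loop(3)] red_loop(2)])
  next
    case s: (bichromatic J)
    have "restrict \<alpha> U = (\<lambda>x\<in>U. 0)"
      unfolding \<alpha> by (rule restrict_ext) (simp add: s(3))
    then show ?thesis ..
  qed
next
  case (green_loop \<epsilon> s)
  note \<alpha> = restrict_ambient_root[OF green_loop(1), of U]
  show ?thesis
  proof (cases s rule: coordinate_on_Ker)
    case s: (red I)
    have eq: "restrict \<alpha> U = (\<lambda>x\<in>U. \<epsilon> * (2 * \<beta> I x))"
      unfolding \<alpha> by (rule restrict_ext) (simp add: s(3))
    show ?thesis
      unfolding eq quotient_roots_def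
      by (intro disjI2 roots_green_loop[OF quotient_loopI[OF s(1,2) green_loop(3)] green_loop(2)])
  next
    case s: (bichromatic J)
    have "restrict \<alpha> U = (\<lambda>x\<in>U. 0)"
      unfolding \<alpha> by (rule restrict_ext) (simp add: s(3))
    then show ?thesis ..
  qed
qed

section \<open>Roots of the quotient graph\<close>

text \<open>The edge of \<open>G\<close> that caused an edge of the quotient graph has a root restricting to the
  given one. The sign and the order of the two ends can be kept, because every rule prescribes in
  which component each end lies.\<close>

lemma quotient_root_is_restriction:
  assumes "\<gamma> \<in> quotient_roots G G'"
  obtains \<alpha> where "\<alpha> \<in> ambient_roots G" "\<gamma> = restrict \<alpha> U"
  using assms unfolding quotient_roots_def
proof (cases rule: rootsE)
  case (red \<epsilon> I J)
  obtain i j where ij: "I \<in> red_components G'" "J \<in> red_components G'" "i \<in> I" "j \<in> J"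
      "({i, j}, Red) \<in> edges G"
    using quotient_straight_edgeE[OF red(4,3)] .
  have "i \<noteq> j"
    using red_components_disjoint[OF ij(1,2) red(3) ij(3)] ij(4) by blast
  then have "(\<lambda>x\<in>UNIV. \<epsilon> * (x $ i - x $ j)) \<in> ambient_roots G"
    unfolding ambient_roots_def using ij(5) red(2) by (rule roots_red)
  moreover have "\<gamma> = restrict (\<lambda>x\<in>UNIV. \<epsilon> * (x $ i - x $ j)) U"
    unfolding red(1) restrict_ambient_root[OF refl]
    by (rule restrict_ext) (simp add: dual_eq[OF _ ij(1,3)] dual_eq[OF _ ij(2,4)])
  ultimately show ?thesis by (rule that)
next
  case (green \<epsilon> I J)
  obtain i j where ij: "I \<in> red_components G'" "J \<in> red_components G'" "i \<in> I" "j \<in> J"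
      "({i, j}, Green) \<in> edges G"
    using quotient_straight_edgeE[OF green(4,3)] .
  have "i \<noteq> j"
    using red_components_disjoint[OF ij(1,2) green(3) ij(3)] ij(4) by blast
  then have "(\<lambda>x\<in>UNIV. \<epsilon> * (x $ i + x $ j)) \<in> ambient_roots G"
    unfolding ambient_roots_def using ij(5) green(2) by (rule roots_green)
  moreover have "\<gamma> = restrict (\<lambda>x\<in>UNIV. \<epsilon> * (x $ i + x $ j)) U"
    unfolding green(1) restrict_ambient_root[OF refl]
    by (rule restrict_ext) (simp add: dual_eq[OF _ ij(1,3)] dual_eq[OF _ ij(2,4)])
  ultimately show ?thesis by (rule that)
next
  case (red_loop \<epsilon> I)
  from red_loop(3) show ?thesis
  proof (cases rule: quotient_loopE)
    case (bichromatic_edge J i j d)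
    have "i \<noteq> j"
      using red_bichromatic_disjoint[OF bichromatic_edge(1,3,4)] bichromatic_edge(5) by blast
    note i = dual_eq[OF _ bichromatic_edge(1,4)] and j = bichromatic_zero[OF bichromatic_edge(3,5)]
    show ?thesis
    proof (cases d)
      case Red
      have "(\<lambda>x\<in>UNIV. \<epsilon> * (x $ i - x $ j)) \<in> ambient_roots G"
        unfolding ambient_roots_def
        using \<open>i \<noteq> j\<close> bichromatic_edge(6)[unfolded Red] red_loop(2) by (rule roots_red)
      moreover have "\<gamma> = restrict (\<lambda>x\<in>UNIV. \<epsilon> * (x $ i - x $ j)) U"
        unfolding red_loop(1) restrict_ambient_root[OF refl]
        by (rule restrict_ext) (simp add: i j)
      ultimately show ?thesis by (rule that)
    next
      case Green
      have "(\<lambda>x\<in>UNIV. \<epsilon> * (x $ i + x $ j)) \<in> ambient_roots G"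
        unfolding ambient_roots_def
        using \<open>i \<noteq> j\<close> bichromatic_edge(6)[unfolded Green] red_loop(2) by (rule roots_green)
      moreover have "\<gamma> = restrict (\<lambda>x\<in>UNIV. \<epsilon> * (x $ i + x $ j)) U"
        unfolding red_loop(1) restrict_ambient_root[OF refl]
        by (rule restrict_ext) (simp add: i j)
      ultimately show ?thesis by (rule that)
    qed
  next
    case (loop i)
    have "(\<lambda>x\<in>UNIV. \<epsilon> * x $ i) \<in> ambient_roots G"
      unfolding ambient_roots_def using loop(3) red_loop(2) by (rule roots_red_loop)
    moreover have "\<gamma> = restrict (\<lambda>x\<in>UNIV. \<epsilon> * x $ i) U"
      unfolding red_loop(1) restrict_ambient_root[OF refl]
      by (rule restrict_ext) (simp add: dual_eq[OF _ loop(1,2)])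
    ultimately show ?thesis by (rule that)
  qed simp
next
  case (green_loop \<epsilon> I)
  from green_loop(3) show ?thesis
  proof (cases rule: quotient_loopE)
    case (green_edge i j)
    have "(\<lambda>x\<in>UNIV. \<epsilon> * (x $ i + x $ j)) \<in> ambient_roots G"
      unfolding ambient_roots_def using green_edge(5,6) green_loop(2) by (rule roots_green)
    moreover have "\<gamma> = restrict (\<lambda>x\<in>UNIV. \<epsilon> * (x $ i + x $ j)) U"
      unfolding green_loop(1) restrict_ambient_root[OF refl]
      by (rule restrict_ext)
        (simp flip: dual_eq[OF _ green_edge(1,3)] dual_eq[OF _ green_edge(1,4)])
    ultimately show ?thesis by (rule that)
  next
    case (loop i)
    have "(\<lambda>x\<in>UNIV. \<epsilon> * (2 * x $ i)) \<in> ambient_roots G"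
      unfolding ambient_roots_def using loop(3) green_loop(2) by (rule roots_green_loop)
    moreover have "\<gamma> = restrict (\<lambda>x\<in>UNIV. \<epsilon> * (2 * x $ i)) U"
      unfolding green_loop(1) restrict_ambient_root[OF refl]
      by (rule restrict_ext) (simp add: dual_eq[OF _ loop(1,2)])
    ultimately show ?thesis by (rule that)
  qed simp
qed

lemma dual_node_vec:
  assumes "I \<in> red_components G'" "J \<in> red_components G'"
  shows "\<beta> J (node_vec I) = (if I = J then 1 else 0)"
proof -
  obtain j where j: "j \<in> J"
    using red_component_nonempty[OF assms(2)] by blast
  have "\<beta> J (node_vec I) = node_vec I $ j"
    by (rule dual_eq[OF node_vec_in_Ker[OF bichromatic assms(1)] assms(2) j])
  then show ?thesis
    using red_components_disjoint[OF assms(2,1) _ j] j by (auto simp: node_vec_nth)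
qed

text \<open>A node \<open>I\<close> of the edge defining the root provides a point of \<open>U\<close> where the root is \<open>\<plusminus>1\<close> or
  \<open>\<plusminus>2\<close>, namely \<open>node_vec I\<close>.\<close>

lemma quotient_root_nonzero:
  assumes "\<gamma> \<in> quotient_roots G G'"
  shows "\<gamma> \<noteq> (\<lambda>x\<in>U. 0)"
proof -
  have red: "I \<in> red_components G'" if "({I}, c) \<in> edges (quotient_graph G G')" for I c
    using that by (rule quotient_loopE)
  have "\<exists>I \<in> red_components G'. \<gamma> (node_vec I) \<noteq> 0"
    using assms unfolding quotient_roots_def
  proof (cases rule: rootsE)
    case (red \<epsilon> I J)
    obtain "I \<in> red_components G'" "J \<in> red_components G'"
      using quotient_straight_edgeE[OF red(4,3)] .
    then show ?thesis
      using red(1-3) by (intro bexI[of _ I]) (auto simp: dual_node_vec node_vec_in_Ker[OF bichromatic])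
  next
    case (green \<epsilon> I J)
    obtain "I \<in> red_components G'" "J \<in> red_components G'"
      using quotient_straight_edgeE[OF green(4,3)] .
    then show ?thesis
      using green(1-3) by (intro bexI[of _ I]) (auto simp: dual_node_vec node_vec_in_Ker[OF bichromatic])
  next
    case (red_loop \<epsilon> I)
    then show ?thesis
      using red[OF red_loop(3)]
      by (intro bexI[of _ I]) (auto simp: dual_node_vec node_vec_in_Ker[OF bichromatic])
  next
    case (green_loop \<epsilon> I)
    then show ?thesis
      using red[OF green_loop(3)]
      by (intro bexI[of _ I]) (auto simp: dual_node_vec node_vec_in_Ker[OF bichromatic])
  qed
  then show ?thesis
    using node_vec_in_Ker[OF bichromatic] by fastforce
qed

section \<open>Comparison of the two sets of covectors\<close>

lemma quotient_roots_eq_nonzero_restrictions: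
  "quotient_roots G G' = restricted_roots G G' - {\<lambda>x\<in>U. 0}"
proof (intro equalityI subsetI)
  fix \<gamma> assume \<gamma>: "\<gamma> \<in> quotient_roots G G'"
  obtain \<alpha> where \<alpha>: "\<alpha> \<in> ambient_roots G" "\<gamma> = restrict \<alpha> U"
    using quotient_root_is_restriction[OF \<gamma>] .
  have "\<gamma> \<noteq> (\<lambda>x\<in>U. 0)"
    by (rule quotient_root_nonzero[OF \<gamma>])
  moreover have "\<alpha> \<notin> ambient_roots G'"
  proof
    assume "\<alpha> \<in> ambient_roots G'"
    then have "restrict \<alpha> U = (\<lambda>x\<in>U. 0)"
      by (intro restrict_ext) (simp add: Ker_def)
    with \<alpha>(2) \<open>\<gamma> \<noteq> (\<lambda>x\<in>U. 0)\<close> show False by simp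
  qed
  ultimately show "\<gamma> \<in> restricted_roots G G' - {\<lambda>x\<in>U. 0}"
    using \<alpha> by (auto simp: restricted_roots_def)
next
  fix \<gamma> assume \<gamma>: "\<gamma> \<in> restricted_roots G G' - {\<lambda>x\<in>U. 0}"
  then obtain \<alpha> where "\<alpha> \<in> ambient_roots G" "\<gamma> = restrict \<alpha> U"
    unfolding restricted_roots_def by blast
  then show "\<gamma> \<in> quotient_roots G G'"
    using restricted_root_zero_or_quotient_root[of \<alpha> G] \<gamma> by simp
qed

end

theorem theorem6p2p1:
  fixes G G' :: "'n::finite bigraph"
  assumes "crystallograph G'" and "crystallograph G"
    and "nodes G = UNIV"
    and "subgraph_same_nodes G' G"
    and "disjoint_union_classical G'" and "disjoint_union_classical G"
  shows "quotient_roots G G' = restricted_roots G G' - {\<lambda>x\<in>Ker (ambient_roots G'). 0} \<and>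
    ((\<forall>\<alpha> \<in> ambient_roots G - ambient_roots G'. \<exists>x \<in> Ker (ambient_roots G'). \<alpha> x \<noteq> 0)
      \<longrightarrow> quotient_roots G G' = restricted_roots G G')"
proof (intro conjI impI)
  have "bichromatic_graph G'" "nodes G' = UNIV"
    using assms by (simp_all add: crystallograph_def subgraph_same_nodes_def)
  then show eq: "quotient_roots G G' = restricted_roots G G' - {\<lambda>x\<in>Ker (ambient_roots G'). 0}"
    using assms(5) by (rule quotient_roots_eq_nonzero_restrictions)
  assume nonvanishing:
    "\<forall>\<alpha> \<in> ambient_roots G - ambient_roots G'. \<exists>x \<in> Ker (ambient_roots G'). \<alpha> x \<noteq> 0"
  have "(\<lambda>x\<in>Ker (ambient_roots G'). 0) \<notin> restricted_roots G G'"
  proof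
    assume "(\<lambda>x\<in>Ker (ambient_roots G'). 0) \<in> restricted_roots G G'"
    then obtain \<alpha> where \<alpha>: "\<alpha> \<in> ambient_roots G - ambient_roots G'"
      "(\<lambda>x\<in>Ker (ambient_roots G'). 0) = restrict \<alpha> (Ker (ambient_roots G'))"
      by (auto simp: restricted_roots_def)
    then obtain x where "x \<in> Ker (ambient_roots G')" "\<alpha> x \<noteq> 0"
      using nonvanishing by blast
    then show False
      using fun_cong[OF \<alpha>(2), of x] by simp
  qed
  with eq show "quotient_roots G G' = restricted_roots G G'"
    by simp
qed

end
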